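(* Let $P:\mathbb{R}^d\to\mathbb{R}^m$ be surjective, and let $T>0$. Assume that for some parameters $[w,b]\in L^1(0,T;\mathbb{R}^{d_u})$ the solution $\mathbf{x}\in C^0([0,T];\mathbb{R}^{d_x})$ to either $$\dot{\mathbf{x}}(t)=\mathbf{w}(t)\sigma(\mathbf{x}(t))+\mathbf{b}(t)\ \text{ on }(0,T),\quad \mathbf{x}(0)=\mathbf{x}^0,\qquad\text{or}\qquad \dot{\mathbf{x}}(t)=\sigma(\mathbf{w}(t)\mathbf{x}(t)+\mathbf{b}(t))\ \text{ on }(0,T),\quad \mathbf{x}(0)=\mathbf{x}^0,$$ satisfies $P\mathbf{x}_i(T)=\vec{y}_i$ for all $i\in[N]$. Then $$\|w\|_{L^1(0,T;\mathbb{R}^{d\times d})}\geqslant\mathfrak{C}(\sigma)\max_{\substack{(i,j)\in[N]^2\\ i\neq j}}\ \inf_{\substack{\mathbf{x}_i^1\in P^{-1}(\{\vec{y}_i\})\\ \mathbf{x}_j^1\in P^{-1}(\{\vec{y}_j\})}}\log\left(\frac{\|\mathbf{x}_i^1-\mathbf{x}_j^1\|}{\|\mathbf{x}_i^0-\mathbf{x}_j^0\|}\right),$$ where $\mathfrak{C}(\sigma)>0$ is the Lipschitz constant of $\sigma\in\mathrm{Lip}(\mathbb{R})$.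
   Context: Write $[n]=\{1,\dots,n\}$. A dataset $\{\vec{x}_i,\vec{y}_i\}_{i\in[N]}$ is given with $\vec{x}_i\in\mathbb{R}^d$, $\vec{x}_i\neq\vec{x}_j$ for $i\neq j$, and $\vec{y}_i\in\mathcal{Y}\subset\mathbb{R}^m$. Set $d_x:=dN$ and $\mathbb{R}^{d_u}:=\mathbb{R}^{d\times(d+1)}$; elements of $\mathbb{R}^{d_u}$ are pairs $[w,b]$ with $w\in\mathbb{R}^{d\times d}$, $b\in\mathbb{R}^d$; $\|\cdot\|$ is the Euclidean norm of vectors and the Frobenius norm of matrices. A vector $\mathbf{x}\in\mathbb{R}^{d_x}$ is viewed as a stack of $N$ sub-vectors $\mathbf{x}_i\in\mathbb{R}^d$; $\mathbf{x}^0$ denotes the stack with $\mathbf{x}^0_i=\vec{x}_i$. Given $[w,b]$, $\mathbf{w}\in\mathbb{R}^{d_x\times d_x}$ is the block-diagonal matrix with $N$ diagonal blocks equal to $w$, and $\mathbf{b}\in\mathbb{R}^{d_x}$ is the stack of $N$ copies of $b$. $\mathrm{Lip}(\mathbb{R})$ is the set of globally Lipschitz functions $\mathbb{R}\to\mathbb{R}$. The activation $\sigma\in\mathrm{Lip}(\mathbb{R})$ satisfies $\sigma(0)=0$ and is applied componentwise to vectors.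
   Formalization: The constant C(σ) is taken to be 1/L, the reciprocal of the Lipschitz constant L of σ; with C(σ) = L the bound fails for L > 1 (e.g. d = 1, σ(r) = 2r, w = 1, b = 0, T = 1, P = id, initial points 0 and 1: 1 ≥ 4 is false). For L ≤ 1 the version here implies the stated one. *)

theory Defs
  imports "HOL-Analysis.Analysis"
begin

(* R^(d N) is real^('n \<times> 'd) with N = CARD('n) and d = CARD('d): coordinate (i, k) is the
   k-th entry of the i-th sub-vector. *)

definition stack :: "('n::finite \<Rightarrow> real^'d) \<Rightarrow> real^('n \<times> 'd::finite)" where
  "stack f = (\<chi> p. f (fst p) $ snd p)"

definition subvec :: "real^('n \<times> 'd) \<Rightarrow> 'n::finite \<Rightarrow> real^'d::finite" where
  "subvec x i = (\<chi> k. x $ (i, k))"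

definition block_diag :: "real^'d^'d \<Rightarrow> real^('n::finite \<times> 'd::finite)^('n \<times> 'd)" where
  "block_diag w = (\<chi> p q. if fst p = fst q then w $ snd p $ snd q else 0)"

definition componentwise :: "(real \<Rightarrow> real) \<Rightarrow> real^'k \<Rightarrow> real^'k::finite" where
  "componentwise \<sigma> x = (\<chi> p. \<sigma> (x $ p))"

definition globally_lipschitz :: "(real \<Rightarrow> real) \<Rightarrow> bool" where
  "globally_lipschitz f \<longleftrightarrow> (\<exists>L. L-lipschitz_on UNIV f)"

(* The least Lipschitz constant L. Gronwall gives |x_i(T) - x_j(T)| \<le> exp (L |w|_1) |x_i(0) - x_j(0)|,
   so the factor in front of the logarithm in the lower bound on |w|_1 has to be 1 / L. A factor L
   fails for L > 1: d = 1, sigma(r) = 2 r, w = 1, b = 0, T = 1, P = id, initial points 0 and 1 give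
   |w|_1 = 1, whereas L * log(e^2 / 1) = 4. *)
definition lipschitz_constant :: "(real \<Rightarrow> real) \<Rightarrow> real" where
  "lipschitz_constant f = Inf {L. L-lipschitz_on UNIV f}"

(* With coefficients that are merely integrable in time, a continuous solution is understood in
   the sense of Caratheodory: the Lebesgue integral form of x' = F(t, x) with x(0) = x0. *)
definition solves_ivp ::
    "real \<Rightarrow> (real \<Rightarrow> real^'k \<Rightarrow> real^'k) \<Rightarrow> real^'k \<Rightarrow> (real \<Rightarrow> real^'k::finite) \<Rightarrow> bool" where
  "solves_ivp T F x0 x \<longleftrightarrow>
     continuous_on {0..T} x \<and>
     (\<forall>t\<in>{0..T}.
        (\<lambda>s. F s (x s)) absolutely_integrable_on {0..t} \<and>
        x t = x0 + (LINT s:{0..t}|lebesgue. F s (x s)))"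

definition field_outer ::
    "(real \<Rightarrow> real) \<Rightarrow> (real \<Rightarrow> real^'d^'d) \<Rightarrow> (real \<Rightarrow> real^'d) \<Rightarrow>
     real \<Rightarrow> real^('n \<times> 'd) \<Rightarrow> real^('n::finite \<times> 'd::finite)" where
  "field_outer \<sigma> w b t x = block_diag (w t) *v componentwise \<sigma> x + stack (\<lambda>_. b t)"

definition field_inner ::
    "(real \<Rightarrow> real) \<Rightarrow> (real \<Rightarrow> real^'d^'d) \<Rightarrow> (real \<Rightarrow> real^'d) \<Rightarrow>
     real \<Rightarrow> real^('n \<times> 'd) \<Rightarrow> real^('n::finite \<times> 'd::finite)" where
  "field_inner \<sigma> w b t x = componentwise \<sigma> (block_diag (w t) *v x + stack (\<lambda>_. b t))"

(* The norm on real^'d^'d is the Frobenius norm. *)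
definition L1_norm :: "real \<Rightarrow> (real \<Rightarrow> real^'d^'d) \<Rightarrow> real" where
  "L1_norm T w = (LINT t:{0<..<T}|lebesgue. norm (w t))"

(* Logarithm on [0, \<infinity>) with log 0 = -\<infinity>; the library's real ln has ln 0 = 0, which would be
   wrong for preimages P^{-1}(y_i), P^{-1}(y_j) that meet. *)
definition log_ext :: "real \<Rightarrow> ereal" where
  "log_ext r = (if r = 0 then -\<infinity> else ereal (ln r))"

end

theory Submission
  imports Defs
begin

text \<open>
  The difference \<open>z = x\<^sub>i - x\<^sub>j\<close> of two trajectories satisfies \<open>|z'| \<le> L |w| |z|\<close>, because the biases
  cancel. Gronwall's inequality bounds \<open>|z(T)|\<close> by \<open>exp (L |w|\<^sub>1) |z(0)|\<close>, and the end points
  \<open>x\<^sub>i(T)\<close>, \<open>x\<^sub>j(T)\<close> are admissible competitors in the infimum. Since \<open>|w|\<close> is merely integrable,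
  Gronwall's inequality is obtained without differentiation: the interval is cut into \<open>n\<close> pieces of
  equal mass \<open>D / n\<close>, over each of which the running maximum grows by a factor of at most
  \<open>1 / (1 - D / n)\<close>, and \<open>n\<close> tends to infinity.
\<close>

section \<open>Gronwall's inequality with an integrable kernel\<close>

text \<open>\<open>K\<close> stands for a primitive of the kernel. The assumption
  \<open>step\<close> is the integral inequality for \<open>u\<close> with \<open>u\<close> replaced
  by an upper bound \<open>C\<close> under the integral, so that only increments of \<open>K\<close>
  occur.\<close>

lemma gronwall_continuous_increments:
  fixes u K :: "real \<Rightarrow> real"
  assumes ab: "a \<le> b"
    and u: "continuous_on {a..b} u" and K: "continuous_on {a..b} K" and mono: "mono_on {a..b} K"
    and nonneg: "\<And>t. t \<in> {a..b} \<Longrightarrow> 0 \<le> u t"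
    and step: "\<And>s t C. \<lbrakk>a \<le> s; s \<le> t; t \<le> b; \<And>r. r \<in> {s..t} \<Longrightarrow> u r \<le> C\<rbrakk>
                 \<Longrightarrow> u t \<le> u s + (K t - K s) * C"
  shows "u b \<le> exp (K b - K a) * u a"
proof -
  define V where "V t = Sup (u ` {a..t})" for t
  define D where "D = K b - K a"
  have bdd: "bdd_above (u ` {a..t})" if "t \<le> b" for t
  proof -
    have "continuous_on {a..t} u"
      using u by (rule continuous_on_subset) (use that in auto)
    then show ?thesis
      by (intro bounded_imp_bdd_above compact_imp_bounded compact_continuous_image) auto
  qed
  have V_upper: "u r \<le> V t" if "a \<le> r" "r \<le> t" "t \<le> b" for r t
    unfolding V_def using that bdd by (intro cSup_upper) auto
  have V_nonneg: "0 \<le> V t" if "a \<le> t" "t \<le> b" for t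
    using V_upper[of t t] nonneg[of t] that by simp
  \<comment> \<open>Values of \<open>u\<close> up to \<open>s\<close> lie below \<open>V s\<close>;
    later ones are bounded by \<open>step\<close> on \<open>{s..r}\<close> with
    \<open>C = V t\<close>. The resulting multiple of \<open>V t\<close> is then moved to the
    left.\<close>
  have V_step: "(1 - (K t - K s)) * V t \<le> V s" if st: "a \<le> s" "s \<le> t" "t \<le> b" for s t
  proof -
    have Kst: "K s \<le> K t"
      using mono st by (auto intro: mono_onD)
    have "V t \<le> V s + (K t - K s) * V t"
      unfolding V_def[of t]
    proof (rule cSup_least)
      show "u ` {a..t} \<noteq> {}" using st by simp
      fix y assume "y \<in> u ` {a..t}"
      then obtain r where r: "a \<le> r" "r \<le> t" "y = u r" by auto
      have V0: "0 \<le> V t" using V_nonneg st by simp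
      show "y \<le> V s + (K t - K s) * Sup (u ` {a..t})"
      proof (cases "r \<le> s")
        case True
        have "0 \<le> (K t - K s) * V t" using Kst V0 by simp
        then show ?thesis
          using V_upper[of r s] True r st by (simp add: V_def)
      next
        case False
        have "u r \<le> u s + (K r - K s) * V t"
          using False r st by (intro step V_upper) auto
        also have "\<dots> \<le> V s + (K t - K s) * V t"
        proof (intro add_mono mult_right_mono diff_right_mono)
          show "K r \<le> K t" using mono r st by (auto intro: mono_onD)
        qed (use V_upper st V0 in auto)
        finally show ?thesis using r by (simp add: V_def)
      qed
    qed
    then show ?thesis by (simp add: algebra_simps)
  qed
  \<comment> \<open>The cut points are taken at equally spaced levels of \<open>K\<close> by the
    intermediate value theorem, since \<open>K\<close> may have flat pieces and hence no inverse.
    The condition \<open>D \<le> real n\<close> keeps the factor \<open>1 - D / n\<close>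
    nonnegative, so the one-step bounds can be multiplied.\<close>
  have chain: "\<exists>\<tau>\<in>{a..b}. K \<tau> = K a + real i * (D / real n) \<and> (1 - D / real n) ^ i * V \<tau> \<le> V a"
    if n: "0 < n" "D \<le> real n" and "i \<le> n" for i n
    using \<open>i \<le> n\<close>
  proof (induction i)
    case 0
    then show ?case using ab by auto
  next
    case (Suc i)
    then obtain \<tau> where \<tau>: "\<tau> \<in> {a..b}" "K \<tau> = K a + real i * (D / real n)"
        "(1 - D / real n) ^ i * V \<tau> \<le> V a"
      by auto
    have D0: "0 \<le> D"
      using mono ab by (auto simp: D_def intro: mono_onD)
    have "real (Suc i) * (D / real n) \<le> real n * (D / real n)"
      using Suc.prems D0 by (intro mult_right_mono) auto
    then have "K a + real (Suc i) * (D / real n) \<le> K b"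
      using n by (simp add: D_def)
    moreover have "K \<tau> \<le> K a + real (Suc i) * (D / real n)"
      using \<tau> D0 by (simp add: divide_right_mono mult_right_mono)
    moreover have "continuous_on {\<tau>..b} K"
      using K by (rule continuous_on_subset) (use \<tau> in auto)
    ultimately obtain \<rho> where \<rho>: "\<tau> \<le> \<rho>" "\<rho> \<le> b" "K \<rho> = K a + real (Suc i) * (D / real n)"
      using IVT'[of K \<tau> "K a + real (Suc i) * (D / real n)" b] \<tau>(1) by auto
    have "K \<rho> - K \<tau> = D / real n"
      using \<rho> \<tau> by (simp add: distrib_right add_divide_distrib)
    then have "(1 - D / real n) * V \<rho> \<le> V \<tau>"
      using V_step[of \<tau> \<rho>] \<rho> \<tau> by simp
    then have "(1 - D / real n) ^ i * ((1 - D / real n) * V \<rho>) \<le> (1 - D / real n) ^ i * V \<tau>"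
      using n by (intro mult_left_mono) (auto simp: divide_simps)
    then show ?case
      using \<rho> \<tau> by (intro bexI[of _ \<rho>]) (auto simp: mult_ac)
  qed
  have total: "(1 + - D / real n) ^ n * V b \<le> V a" if n: "0 < n" "D \<le> real n" for n
  proof -
    obtain \<tau> where \<tau>: "\<tau> \<in> {a..b}" "K \<tau> = K a + real n * (D / real n)"
        "(1 - D / real n) ^ n * V \<tau> \<le> V a"
      using chain[of n n] n by auto
    \<comment> \<open>The last cut point may lie strictly before \<open>b\<close>, but there
      \<open>K \<tau> = K b\<close>, so the factor in \<open>V_step\<close> is 1.\<close>
    then have "V b \<le> V \<tau>"
      using V_step[of \<tau> b] n by (simp add: D_def)
    then have "(1 - D / real n) ^ n * V b \<le> (1 - D / real n) ^ n * V \<tau>"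
      using n by (intro mult_left_mono) (auto simp: divide_simps)
    then show ?thesis using \<tau> by simp
  qed
  have "(\<lambda>n. (1 + - D / real n) ^ n * V b) \<longlonglongrightarrow> exp (- D) * V b"
    by (intro tendsto_mult tendsto_exp_limit_sequentially tendsto_const)
  \<comment> \<open>The threshold \<open>max 1 (nat \<lceil>D\<rceil>)\<close> secures both
    conditions of \<open>total\<close>, and the bound then passes to the limit.\<close>
  moreover have "\<forall>\<^sub>F n in sequentially. (1 + - D / real n) ^ n * V b \<le> V a"
    using eventually_ge_at_top[of "max 1 (nat \<lceil>D\<rceil>)"]
    by eventually_elim (rule total; linarith)
  ultimately have "exp (- D) * V b \<le> V a"
    by (intro tendsto_upperbound) auto
  then have "V b \<le> exp D * V a"
    by (simp add: exp_minus field_simps)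
  moreover have "V a = u a" by (simp add: V_def)
  ultimately show ?thesis
    using V_upper[of b b] ab by (simp add: D_def)
qed

text \<open>The preceding lemma applies to the norm of \<open>z\<close> and the primitive of
  \<open>k\<close>: on \<open>{s..t}\<close> the integrand \<open>g\<close> is dominated by
  \<open>k r * C\<close>, whose integral is the increment of the primitive times
  \<open>C\<close>.\<close>

lemma gronwall_integrable_kernel:
  fixes z :: "real \<Rightarrow> 'a::euclidean_space" and k :: "real \<Rightarrow> real"
  assumes ab: "a \<le> b"
    and z: "continuous_on {a..b} z"
    and g: "g integrable_on {a..b}"
    and k: "k integrable_on {a..b}" and k0: "\<And>s. 0 \<le> k s"
    and sol: "\<And>t. t \<in> {a..b} \<Longrightarrow> z t = z a + integral {a..t} g"
    and le: "\<And>s. s \<in> {a..b} \<Longrightarrow> norm (g s) \<le> k s * norm (z s)"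
  shows "norm (z b) \<le> exp (integral {a..b} k) * norm (z a)"
proof -
  define K where "K t = integral {a..t} k" for t
  have incr: "integral {a..t} f - integral {a..s} f = integral {s..t} f"
    if "a \<le> s" "s \<le> t" "t \<le> b" "f integrable_on {a..b}"
    for s t and f :: "real \<Rightarrow> 'c::euclidean_space"
    using that Henstock_Kurzweil_Integration.integral_combine[of a s t f]
      integrable_on_subinterval[of f "{a..b}" a t]
    by (auto simp: algebra_simps)
  have sub: "f integrable_on {s..t}" if "a \<le> s" "s \<le> t" "t \<le> b" "f integrable_on {a..b}"
    for s t and f :: "real \<Rightarrow> 'c::euclidean_space"
    using that integrable_on_subinterval[of f "{a..b}" s t] by auto
  have "norm (z b) \<le> exp (K b - K a) * norm (z a)"
  proof (rule gronwall_continuous_increments[OF ab])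
    show "continuous_on {a..b} (\<lambda>t. norm (z t))"
      using z by (intro continuous_intros)
    show "continuous_on {a..b} K"
      unfolding K_def using k by (rule indefinite_integral_continuous_1)
    show "mono_on {a..b} K"
    proof (rule mono_onI)
      fix s t assume st: "s \<in> {a..b}" "t \<in> {a..b}" "s \<le> t"
      then have "0 \<le> integral {s..t} k"
        using k k0 sub[of s t k] by (intro integral_nonneg) auto
      then show "K s \<le> K t"
        using incr[of s t k] st k by (simp add: K_def)
    qed
    fix s t C
    assume st: "a \<le> s" "s \<le> t" "t \<le> b" and C: "\<And>r. r \<in> {s..t} \<Longrightarrow> norm (z r) \<le> C"
    have "z t - z s = integral {s..t} g"
      using sol[of t] sol[of s] incr[of s t g] st g by simp
    moreover have "norm (integral {s..t} g) \<le> integral {s..t} (\<lambda>r. k r * C)"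
    proof (rule integral_norm_bound_integral)
      fix r assume r: "r \<in> {s..t}"
      then have "norm (g r) \<le> k r * norm (z r)" using le st by auto
      also have "\<dots> \<le> k r * C" using C[OF r] k0 by (intro mult_left_mono)
      finally show "norm (g r) \<le> k r * C" .
    qed (use sub[of s t] st g k in \<open>auto intro: integrable_on_mult_left\<close>)
    moreover have "integral {s..t} (\<lambda>r. k r * C) = (K t - K s) * C"
      using incr[of s t k] st k by (simp add: K_def del: mult_cancel_right)
    ultimately show "norm (z t) \<le> norm (z s) + (K t - K s) * C"
      using norm_triangle_ineq2[of "z t" "z s"] by (metis add.commute diff_le_eq order_trans)
  qed simp
  then show ?thesis by (simp add: K_def)
qed

section \<open>Lipschitz and matrix norm estimates\<close>

text \<open>The infimum is attained: every difference quotient of \<open>f\<close> is a lower bound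
  for the set of admissible constants, hence at most its infimum.\<close>

lemma lipschitz_on_lipschitz_constant:
  assumes "globally_lipschitz f"
  shows "(lipschitz_constant f)-lipschitz_on UNIV f"
proof -
  define S where "S = {L. L-lipschitz_on UNIV f}"
  have ne: "S \<noteq> {}" using assms by (auto simp: globally_lipschitz_def S_def)
  have nonneg: "0 \<le> L" if "L \<in> S" for L
    using that lipschitz_on_nonneg by (auto simp: S_def)
  show ?thesis
    unfolding lipschitz_constant_def S_def[symmetric]
  proof (rule lipschitz_onI)
    show "0 \<le> Inf S" using ne nonneg by (intro cInf_greatest) auto
    fix x y :: real
    show "dist (f x) (f y) \<le> Inf S * dist x y"
    proof (cases "x = y")
      case False
      then have "dist (f x) (f y) / dist x y \<le> Inf S"
        using ne by (intro cInf_greatest)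
          (auto simp: S_def divide_le_eq dest: lipschitz_onD)
      then show ?thesis using False by (simp add: divide_le_eq)
    qed simp
  qed
qed

text \<open>The Frobenius norm is the Euclidean norm of the row norms, so Cauchy-Schwarz in each row
  suffices.\<close>

lemma norm_matrix_vector_mult_le:
  fixes A :: "real^'n^'m"
  shows "norm (A *v x) \<le> norm A * norm x"
proof -
  have "norm (A *v x) = L2_set (\<lambda>i. norm (A $ i \<bullet> x)) UNIV"
    by (simp add: norm_vec_def matrix_mult_dot)
  also have "\<dots> \<le> L2_set (\<lambda>i. norm (A $ i) * norm x) UNIV"
    by (intro L2_set_mono) (auto simp: Cauchy_Schwarz_ineq2)
  also have "\<dots> = norm A * norm x"
    by (simp add: norm_vec_def[of A] L2_set_left_distrib)
  finally show ?thesis .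
qed

text \<open>Each entry of the difference is dominated by that of \<open>L *\<^sub>R (x - y)\<close>,
  and the Euclidean norm is monotone in absolute entries; no dimensional factor arises.\<close>

lemma norm_componentwise_diff_le:
  assumes "L-lipschitz_on UNIV \<sigma>"
  shows "norm (componentwise \<sigma> x - componentwise \<sigma> y) \<le> L * norm (x - y)"
proof -
  have "norm (componentwise \<sigma> x - componentwise \<sigma> y) \<le> norm (L *\<^sub>R (x - y))"
    using lipschitz_onD[OF assms] lipschitz_on_nonneg[OF assms]
    by (intro norm_le_componentwise_cart)
      (auto simp: componentwise_def dist_real_def abs_mult)
  then show ?thesis using lipschitz_on_nonneg[OF assms] by simp
qed

section \<open>Sub-vectors of the stacked system\<close>

lemma subvec_add: "subvec (x + y) i = subvec x i + subvec y i"
  by (simp add: subvec_def vec_eq_iff)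

lemma subvec_stack: "subvec (stack f) i = f i"
  by (simp add: subvec_def stack_def vec_eq_iff)

lemma subvec_componentwise: "subvec (componentwise \<sigma> x) i = componentwise \<sigma> (subvec x i)"
  by (simp add: subvec_def componentwise_def vec_eq_iff)

text \<open>The sum over index pairs splits into a double sum, of which only the block
  \<open>j = i\<close> survives.\<close>

lemma subvec_block_diag_mult: "subvec (block_diag w *v x) i = w *v subvec x i"
proof (rule vec_eq_iff[THEN iffD2], rule allI)
  fix k
  have "subvec (block_diag w *v x) i $ k =
      (\<Sum>q\<in>UNIV. (if i = fst q then w $ k $ snd q else 0) * x $ q)"
    by (simp add: subvec_def block_diag_def matrix_vector_mult_def cong: if_cong)
  also have "\<dots> = (\<Sum>j\<in>UNIV. \<Sum>l\<in>UNIV. (if i = j then w $ k $ l else 0) * x $ (j, l))"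
    by (simp add: UNIV_Times_UNIV[symmetric] sum.cartesian_product case_prod_beta
        del: UNIV_Times_UNIV)
  also have "\<dots> = (\<Sum>j\<in>UNIV. if i = j then \<Sum>l\<in>UNIV. w $ k $ l * x $ (j, l) else 0)"
    by (intro sum.cong) auto
  also have "\<dots> = (w *v subvec x i) $ k"
    by (simp add: subvec_def matrix_vector_mult_def)
  finally show "subvec (block_diag w *v x) i $ k = (w *v subvec x i) $ k" .
qed

lemma bounded_linear_subvec: "bounded_linear (\<lambda>x. subvec x i)"
  by (rule linear_conv_bounded_linear[THEN iffD1], rule linearI)
    (simp_all add: subvec_def vec_eq_iff)

section \<open>Separation of two trajectories\<close>

text \<open>All sub-vectors share \<open>w t\<close> and \<open>b t\<close>: the bias cancels and
  \<open>w t\<close> factors out of the difference.\<close>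

lemma norm_subvec_field_outer_diff_le:
  assumes "L-lipschitz_on UNIV \<sigma>"
  shows "norm (subvec (field_outer \<sigma> w b t x) i - subvec (field_outer \<sigma> w b t x) j)
          \<le> L * norm (w t) * norm (subvec x i - subvec x j)"
proof -
  have "norm (subvec (field_outer \<sigma> w b t x) i - subvec (field_outer \<sigma> w b t x) j)
      = norm (w t *v (componentwise \<sigma> (subvec x i) - componentwise \<sigma> (subvec x j)))"
    by (simp add: field_outer_def subvec_add subvec_stack subvec_block_diag_mult
        subvec_componentwise matrix_vector_mult_diff_distrib)
  also have "\<dots> \<le> norm (w t) * norm (componentwise \<sigma> (subvec x i) - componentwise \<sigma> (subvec x j))"
    by (rule norm_matrix_vector_mult_le)
  also have "\<dots> \<le> norm (w t) * (L * norm (subvec x i - subvec x j))"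
    by (intro mult_left_mono norm_componentwise_diff_le assms) simp
  finally show ?thesis by (simp add: mult_ac)
qed

text \<open>The bias sits inside the activation here, so the Lipschitz bound comes first and the
  bias cancels afterwards.\<close>

lemma norm_subvec_field_inner_diff_le:
  assumes "L-lipschitz_on UNIV \<sigma>"
  shows "norm (subvec (field_inner \<sigma> w b t x) i - subvec (field_inner \<sigma> w b t x) j)
          \<le> L * norm (w t) * norm (subvec x i - subvec x j)"
proof -
  have "norm (subvec (field_inner \<sigma> w b t x) i - subvec (field_inner \<sigma> w b t x) j)
      = norm (componentwise \<sigma> (w t *v subvec x i + b t) - componentwise \<sigma> (w t *v subvec x j + b t))"
    by (simp add: field_inner_def subvec_add subvec_stack subvec_block_diag_mult
        subvec_componentwise)
  also have "\<dots> \<le> L * norm ((w t *v subvec x i + b t) - (w t *v subvec x j + b t))"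
    by (intro norm_componentwise_diff_le assms)
  also have "\<dots> = L * norm (w t *v (subvec x i - subvec x j))"
    by (simp add: matrix_vector_mult_diff_distrib)
  also have "\<dots> \<le> L * (norm (w t) * norm (subvec x i - subvec x j))"
    by (intro mult_left_mono norm_matrix_vector_mult_le lipschitz_on_nonneg[OF assms])
  finally show ?thesis by (simp add: mult_ac)
qed

text \<open>The bound \<open>F\<close> is what both dynamics have in common. The difference of two
  sub-vectors is a linear map of the stack, so it commutes with the integral in the solution formula
  and Gronwall applies to it.\<close>

lemma solution_separation_le:
  fixes w :: "real \<Rightarrow> real^'d^'d::finite" and x :: "real \<Rightarrow> real^('n::finite \<times> 'd)"
  assumes T: "0 \<le> T" and L: "0 \<le> L"
    and w: "w absolutely_integrable_on {0<..<T}"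
    and sol: "solves_ivp T F x0 x"
    and F: "\<And>s y. norm (subvec (F s y) i - subvec (F s y) j)
                     \<le> L * norm (w s) * norm (subvec y i - subvec y j)"
  shows "norm (subvec (x T) i - subvec (x T) j)
          \<le> exp (L * L1_norm T w) * norm (subvec x0 i - subvec x0 j)"
proof -
  define d where "d y = subvec y i - subvec y j" for y :: "real^('n \<times> 'd)"
  have d: "bounded_linear d"
    unfolding d_def by (intro bounded_linear_sub bounded_linear_subvec)
  let ?G = "\<lambda>s. F s (x s)"
  have G: "?G absolutely_integrable_on {0..t}" "x t = x0 + integral {0..t} ?G"
    if "t \<in> {0..T}" for t
    using sol that by (auto simp: solves_ivp_def set_lebesgue_integral_eq_integral)
  have x_0: "x 0 = x0" using G(2)[of 0] T by simp
  have kT: "(\<lambda>s. norm (w s)) absolutely_integrable_on {0<..<T}"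
    using absolutely_integrable_norm[OF w] by (simp add: o_def)
  have k_open: "(\<lambda>s. norm (w s)) integrable_on {0<..<T}"
    using kT by (rule set_lebesgue_integral_eq_integral)
  \<comment> \<open>The cost is a Lebesgue integral over the open interval, Gronwall uses the gauge
    integral over the closed one; the end points do not affect the value.\<close>
  have L1: "L1_norm T w = integral {0..T} (\<lambda>s. norm (w s))"
    using kT by (simp add: L1_norm_def set_lebesgue_integral_eq_integral integral_open_interval_real)
  have "norm (d (x T)) \<le> exp (integral {0..T} (\<lambda>s. L * norm (w s))) * norm (d (x 0))"
  proof (rule gronwall_integrable_kernel[where g = "\<lambda>s. d (F s (x s))"])
    show "continuous_on {0..T} (\<lambda>t. d (x t))"
      using sol by (intro bounded_linear.continuous_on[OF d]) (simp add: solves_ivp_def)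
    show "(\<lambda>s. d (F s (x s))) integrable_on {0..T}"
      using integrable_linear[OF _ d, of ?G "{0..T}"] G(1)[of T] T
      by (simp add: o_def set_lebesgue_integral_eq_integral)
    show "(\<lambda>s. L * norm (w s)) integrable_on {0..T}"
      using k_open by (intro integrable_on_mult_right) (simp add: integrable_on_open_interval_real)
    show "d (x t) = d (x 0) + integral {0..t} (\<lambda>s. d (F s (x s)))" if "t \<in> {0..T}" for t
    proof -
      have "?G integrable_on {0..t}"
        using G(1)[OF that] by (rule set_lebesgue_integral_eq_integral)
      then have "integral {0..t} (\<lambda>s. d (F s (x s))) = d (integral {0..t} ?G)"
        using integral_linear[OF _ d, of ?G "{0..t}"] by (simp add: o_def)
      then show ?thesis
        using G(2)[OF that] x_0 by (simp add: linear_add[OF bounded_linear.linear[OF d]])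
    qed
    show "norm (d (F s (x s))) \<le> L * norm (w s) * norm (d (x s))" for s
      using F by (simp add: d_def)
  qed (use T L in auto)
  then show ?thesis by (simp add: d_def L1 x_0)
qed

text \<open>For \<open>r = 0\<close> the left side is minus infinity; otherwise this is monotonicity
  of \<open>ln\<close>.\<close>

lemma log_ext_divide_le:
  assumes "0 \<le> r" "0 < s" "r \<le> exp c * s"
  shows "log_ext (r / s) \<le> ereal c"
proof (cases "r = 0")
  case False
  then have "0 < r / s" "r / s \<le> exp c"
    using assms by (auto simp: divide_simps)
  then have "ln (r / s) \<le> c"
    by (metis ln_exp ln_le_cancel_iff exp_gt_zero)
  then show ?thesis using False assms by (simp add: log_ext_def)
qed (simp add: log_ext_def)

theorem proposition5p1:
  fixes xs :: "'n::finite \<Rightarrow> real^'d::finite"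
    and ys :: "'n \<Rightarrow> real^'m::finite"
    and Y :: "(real^'m) set"
    and P :: "real^'d \<Rightarrow> real^'m"
    and \<sigma> :: "real \<Rightarrow> real"
    and T :: real
    and w :: "real \<Rightarrow> real^'d^'d"
    and b :: "real \<Rightarrow> real^'d"
    and x :: "real \<Rightarrow> real^('n \<times> 'd)"
  assumes "CARD('n) \<ge> 2"
    and "\<And>i j. i \<noteq> j \<Longrightarrow> xs i \<noteq> xs j"
    and "\<And>i. ys i \<in> Y"
    and "globally_lipschitz \<sigma>"
    and "lipschitz_constant \<sigma> > 0"
    and "\<sigma> 0 = 0"
    and "surj P"
    and "T > 0"
    and "(\<lambda>t. (w t, b t)) absolutely_integrable_on {0<..<T}"
    and "solves_ivp T (field_outer \<sigma> w b) (stack xs) x \<or>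
         solves_ivp T (field_inner \<sigma> w b) (stack xs) x"
    and "\<And>i. P (subvec (x T) i) = ys i"
  shows "ereal (L1_norm T w) \<ge>
           ereal (1 / lipschitz_constant \<sigma>) *
           Max {INF p\<in>P -` {ys i}. INF q\<in>P -` {ys j}.
                  log_ext (norm (p - q) / norm (subvec (stack xs) i - subvec (stack xs) j)) |
                i j. i \<noteq> j}"
proof -
  define L where "L = lipschitz_constant \<sigma>"
  have L: "0 < L" using assms(5) by (simp add: L_def)
  have lip: "L-lipschitz_on UNIV \<sigma>"
    unfolding L_def by (rule lipschitz_on_lipschitz_constant[OF assms(4)])
  have w: "w absolutely_integrable_on {0<..<T}"
    using absolutely_integrable_linear[OF assms(9) bounded_linear_fst] by (simp add: o_def)
  have growth: "norm (subvec (x T) i - subvec (x T) j)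
      \<le> exp (L * L1_norm T w) * norm (subvec (stack xs) i - subvec (stack xs) j)" for i j
    using assms(10)
  proof
    assume "solves_ivp T (field_outer \<sigma> w b) (stack xs) x"
    then show ?thesis
      using assms(8) L w norm_subvec_field_outer_diff_le[OF lip]
      by (intro solution_separation_le[where F = "field_outer \<sigma> w b"]) auto
  next
    assume "solves_ivp T (field_inner \<sigma> w b) (stack xs) x"
    then show ?thesis
      using assms(8) L w norm_subvec_field_inner_diff_le[OF lip]
      by (intro solution_separation_le[where F = "field_inner \<sigma> w b"]) auto
  qed
  define I where "I i j = (INF p\<in>P -` {ys i}. INF q\<in>P -` {ys j}.
      log_ext (norm (p - q) / norm (subvec (stack xs) i - subvec (stack xs) j)))" for i j
  have I_le: "I i j \<le> ereal (L * L1_norm T w)" if "i \<noteq> j" for i j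
  proof -
    have "I i j \<le> log_ext (norm (subvec (x T) i - subvec (x T) j)
        / norm (subvec (stack xs) i - subvec (stack xs) j))"
      unfolding I_def using assms(11)
      by (intro INF_lower2[of "subvec (x T) i"] INF_lower2[of "subvec (x T) j"]) auto
    also have "\<dots> \<le> ereal (L * L1_norm T w)"
      using growth assms(2)[OF that] by (intro log_ext_divide_le) (auto simp: subvec_stack)
    finally show ?thesis .
  qed
  \<comment> \<open>Two distinct indices make the set of pairs nonempty, as the bound on
    \<open>Max\<close> requires.\<close>
  obtain i0 j0 :: 'n where "i0 \<noteq> j0"
    using assms(1) card_le_Suc0_iff_eq[of "UNIV :: 'n set"] by fastforce
  have "{I i j | i j. i \<noteq> j} = (\<lambda>(i, j). I i j) ` {(i, j). i \<noteq> j}" by auto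
  then have "finite {I i j | i j. i \<noteq> j}" by simp
  moreover have "{I i j | i j. i \<noteq> j} \<noteq> {}" using \<open>i0 \<noteq> j0\<close> by auto
  ultimately have "Max {I i j | i j. i \<noteq> j} \<le> ereal (L * L1_norm T w)"
    using I_le by (auto simp: Max_le_iff)
  \<comment> \<open>The division by \<open>L\<close> takes place in \<open>ereal\<close>, because
    the maximum may be minus infinity.\<close>
  then have "ereal (1 / L) * Max {I i j | i j. i \<noteq> j} \<le> ereal (1 / L) * ereal (L * L1_norm T w)"
    using L by (intro ereal_mult_left_mono) auto
  also have "\<dots> = ereal (L1_norm T w)" using L by simp
  finally show ?thesis unfolding I_def L_def .
qed

end
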